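(* Let $(M,g,q)$ be a $3$-dimensional Riemannian manifold with circulant metric $g$ and circulant structure $q$ (as described in the context) whose curvature tensor satisfies $R(qx,qy,qz,qu)=R(x,y,z,u)$ for all $x,y,z,u$. If a vector $u\in T_pM$ induces a $q$-basis of $T_pM$, then $$\mu(\varphi)=\frac{1-2\cos\varphi}{1+\cos\varphi}\,\mu\Big(\frac{\pi}{2}\Big)+\frac{3\cos\varphi}{1+\cos\varphi}\,\mu\Big(\frac{\pi}{3}\Big),$$ where $\varphi=\angle(u,qu)$.
   Context: $(M,g,q)$ denotes a $3$-dimensional Riemannian manifold $M$ with local coordinates $(X^1,X^2,X^3)$ and coordinate basis $\{e_i\}$ of the tangent space $T_pM$, where the metric $g$ has the component matrix $$(g_{ij})=\begin{pmatrix} A & B & B \\ B & A & B \\ B & B & A \end{pmatrix},$$ with $A,B$ smooth functions of $X^1,X^2,X^3$ satisfying $A>B>0$, and $q$ is the endomorphism of the tangent spaces with coordinate matrix $$(q_i^{.j})=\begin{pmatrix}0&1&0\\0&0&1\\1&0&0\end{pmatrix},$$ so that $q^3=\mathrm{id}$ and $g(qx,qy)=g(x,y)$. With $\nabla$ the Levi-Civita connection of $g$, $R(x,y)z=\nabla_x\nabla_yz-\nabla_y\nabla_xz-\nabla_{[x,y]}z$ and $R(x,y,z,u)=g(R(x,y)z,u)$. A vector $x\in T_pM$ induces a $q$-basis if $\{x,qx,q^2x\}$ is a basis of $T_pM$; in that case $\angle(x,qx)=\angle(qx,q^2x)=\angle(x,q^2x)\in(0,\tfrac{2\pi}{3})$,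 and an orthogonal $q$-basis of $T_pM$ exists. The sectional curvature of the $2$-plane spanned by $x,y\in T_pM$ is $$\mu(x,y)=\frac{R(x,y,x,y)}{g(x,x)g(y,y)-g^2(x,y)}.$$ For $x\in T_pM$ inducing a $q$-basis, $\mu(x,qx)$ depends (at the fixed point $p$) only on $\varphi=\angle(x,qx)$, and one writes $\mu(\varphi)=\mu(x,qx)$; thus $\mu(\pi/2)$ and $\mu(\pi/3)$ are the values of $\mu(x,qx)$ at $p$ for vectors $x$ inducing a $q$-basis with $\angle(x,qx)=\pi/2$, respectively $\pi/3$. *)

theory Defs
  imports "HOL-Analysis.Analysis"
begin

section \<open>Smooth 3-manifolds with a Riemannian metric\<close>

definition partial :: "3 \<Rightarrow> (real^3 \<Rightarrow> real) \<Rightarrow> real^3 \<Rightarrow> real" where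
  "partial i f x = frechet_derivative f (at x) (axis i 1)"

text \<open>\<open>C_on k S f\<close> says that \<open>f\<close> is of class \<open>C\<^sup>k\<close> on \<open>S\<close>; it is only used for open \<open>S\<close>.\<close>

primrec C_on :: "nat \<Rightarrow> (real^3) set \<Rightarrow> (real^3 \<Rightarrow> real) \<Rightarrow> bool" where
  "C_on 0 S f \<longleftrightarrow> continuous_on S f"
| "C_on (Suc k) S f \<longleftrightarrow> (\<forall>x\<in>S. f differentiable (at x)) \<and> (\<forall>i. C_on k S (partial i f))"

definition smooth_on :: "(real^3) set \<Rightarrow> (real^3 \<Rightarrow> real) \<Rightarrow> bool" where
  "smooth_on S f \<longleftrightarrow> (\<forall>k. C_on k S f)"

type_synonym 'm chart = "'m set \<times> ('m \<Rightarrow> real^3)"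

definition chart_inv :: "'m chart \<Rightarrow> real^3 \<Rightarrow> 'm" where
  "chart_inv c = inv_into (fst c) (snd c)"

definition is_chart :: "'m topology \<Rightarrow> 'm chart \<Rightarrow> bool" where
  "is_chart M c \<longleftrightarrow> openin M (fst c) \<and> open (snd c ` fst c) \<and>
     homeomorphic_map (subtopology M (fst c)) (top_of_set (snd c ` fst c)) (snd c)"

definition smooth_manifold :: "'m topology \<Rightarrow> 'm chart set \<Rightarrow> bool" where
  "smooth_manifold M \<A> \<longleftrightarrow> Hausdorff_space M \<and> second_countable M \<and>
     (\<forall>c\<in>\<A>. is_chart M c) \<and> (\<Union>c\<in>\<A>. fst c) = topspace M \<and>
     (\<forall>c\<in>\<A>. \<forall>d\<in>\<A>. \<forall>i. smooth_on (snd c ` (fst c \<inter> fst d)) (\<lambda>x. snd d (chart_inv c x) $ i))"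

definition smooth_fun :: "'m chart \<Rightarrow> ('m \<Rightarrow> real) \<Rightarrow> bool" where
  "smooth_fun c f \<longleftrightarrow> smooth_on (snd c ` fst c) (f \<circ> chart_inv c)"

text \<open>A tangent vector at a point of the domain of a chart \<open>c\<close> is represented by its components
  with respect to the coordinate basis of \<open>c\<close>. A metric \<open>G\<close> is represented by its component
  matrices \<open>G c p\<close>, subject to the transformation law of a covariant 2-tensor.\<close>

definition jacobian :: "'m chart \<Rightarrow> 'm chart \<Rightarrow> 'm \<Rightarrow> real^3^3" where
  "jacobian c d p = (\<chi> i j. partial j (\<lambda>x. snd d (chart_inv c x) $ i) (snd c p))"

definition riemannian_metric :: "'m chart set \<Rightarrow> ('m chart \<Rightarrow> 'm \<Rightarrow> real^3^3) \<Rightarrow> bool" where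
  "riemannian_metric \<A> G \<longleftrightarrow>
     (\<forall>c\<in>\<A>. (\<forall>i j. smooth_fun c (\<lambda>p. G c p $ i $ j)) \<and>
        (\<forall>p\<in>fst c. transpose (G c p) = G c p \<and> (\<forall>x. x \<noteq> 0 \<longrightarrow> x \<bullet> (G c p *v x) > 0))) \<and>
     (\<forall>c\<in>\<A>. \<forall>d\<in>\<A>. \<forall>p\<in>fst c \<inter> fst d.
        G c p = transpose (jacobian c d p) ** G d p ** jacobian c d p)"

section \<open>Levi-Civita connection and curvature in a coordinate neighbourhood\<close>

text \<open>From here on everything takes place on the domain of one chart \<open>c\<close>: \<open>g\<close> is the matrix
  field of the metric in \<open>c\<close>, and a vector field on the domain is given by its component
  function \<open>'m \<Rightarrow> real^3\<close>, whose values outside the domain are irrelevant.\<close>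

definition inner_g :: "('m \<Rightarrow> real^3^3) \<Rightarrow> 'm \<Rightarrow> real^3 \<Rightarrow> real^3 \<Rightarrow> real" where
  "inner_g g p x y = x \<bullet> (g p *v y)"

definition smooth_field :: "'m chart \<Rightarrow> ('m \<Rightarrow> real^3) \<Rightarrow> bool" where
  "smooth_field c X \<longleftrightarrow> (\<forall>i. smooth_fun c (\<lambda>p. X p $ i))"

definition dir_deriv :: "'m chart \<Rightarrow> ('m \<Rightarrow> real^3) \<Rightarrow> ('m \<Rightarrow> real) \<Rightarrow> 'm \<Rightarrow> real" where
  "dir_deriv c X f p = (\<Sum>i\<in>UNIV. X p $ i * partial i (f \<circ> chart_inv c) (snd c p))"

definition lie_bracket :: "'m chart \<Rightarrow> ('m \<Rightarrow> real^3) \<Rightarrow> ('m \<Rightarrow> real^3) \<Rightarrow> 'm \<Rightarrow> real^3" where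
  "lie_bracket c X Y p =
     (\<chi> k. dir_deriv c X (\<lambda>r. Y r $ k) p - dir_deriv c Y (\<lambda>r. X r $ k) p)"

definition affine_connection ::
  "'m chart \<Rightarrow> (('m \<Rightarrow> real^3) \<Rightarrow> ('m \<Rightarrow> real^3) \<Rightarrow> 'm \<Rightarrow> real^3) \<Rightarrow> bool" where
  "affine_connection c D \<longleftrightarrow>
     (\<forall>X Y. smooth_field c X \<and> smooth_field c Y \<longrightarrow> smooth_field c (D X Y)) \<and>
     (\<forall>f X Y Z. smooth_fun c f \<and> smooth_field c X \<and> smooth_field c Y \<and> smooth_field c Z \<longrightarrow>
        (\<forall>p\<in>fst c.
           D (\<lambda>r. X r + Y r) Z p = D X Z p + D Y Z p \<and>
           D (\<lambda>r. f r *\<^sub>R X r) Z p = f p *\<^sub>R D X Z p \<and>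
           D X (\<lambda>r. Y r + Z r) p = D X Y p + D X Z p \<and>
           D X (\<lambda>r. f r *\<^sub>R Y r) p = dir_deriv c X f p *\<^sub>R Y p + f p *\<^sub>R D X Y p))"

definition levi_civita ::
  "'m chart \<Rightarrow> ('m \<Rightarrow> real^3^3) \<Rightarrow> (('m \<Rightarrow> real^3) \<Rightarrow> ('m \<Rightarrow> real^3) \<Rightarrow> 'm \<Rightarrow> real^3) \<Rightarrow> bool" where
  "levi_civita c g D \<longleftrightarrow> affine_connection c D \<and>
     (\<forall>X Y Z. smooth_field c X \<and> smooth_field c Y \<and> smooth_field c Z \<longrightarrow>
        (\<forall>p\<in>fst c.
           D X Y p - D Y X p = lie_bracket c X Y p \<and>
           dir_deriv c X (\<lambda>r. inner_g g r (Y r) (Z r)) p =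
             inner_g g p (D X Y p) (Z p) + inner_g g p (Y p) (D X Z p)))"

definition curvature_op ::
  "'m chart \<Rightarrow> (('m \<Rightarrow> real^3) \<Rightarrow> ('m \<Rightarrow> real^3) \<Rightarrow> 'm \<Rightarrow> real^3) \<Rightarrow>
   ('m \<Rightarrow> real^3) \<Rightarrow> ('m \<Rightarrow> real^3) \<Rightarrow> ('m \<Rightarrow> real^3) \<Rightarrow> 'm \<Rightarrow> real^3" where
  "curvature_op c D X Y Z p =
     D X (D Y Z) p - D Y (D X Z) p - D (lie_bracket c X Y) Z p"

text \<open>The curvature tensor on tangent vectors at \<open>p\<close>: the vectors are extended to the vector fields
  with constant components. By tensoriality the value does not depend on the extension.\<close>

definition curvature ::
  "'m chart \<Rightarrow> ('m \<Rightarrow> real^3^3) \<Rightarrow> (('m \<Rightarrow> real^3) \<Rightarrow> ('m \<Rightarrow> real^3) \<Rightarrow> 'm \<Rightarrow> real^3) \<Rightarrow>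
   'm \<Rightarrow> real^3 \<Rightarrow> real^3 \<Rightarrow> real^3 \<Rightarrow> real^3 \<Rightarrow> real" where
  "curvature c g D p x y z u =
     inner_g g p (curvature_op c D (\<lambda>_. x) (\<lambda>_. y) (\<lambda>_. z) p) u"

definition sectional ::
  "'m chart \<Rightarrow> ('m \<Rightarrow> real^3^3) \<Rightarrow> (('m \<Rightarrow> real^3) \<Rightarrow> ('m \<Rightarrow> real^3) \<Rightarrow> 'm \<Rightarrow> real^3) \<Rightarrow>
   'm \<Rightarrow> real^3 \<Rightarrow> real^3 \<Rightarrow> real" where
  "sectional c g D p x y = curvature c g D p x y x y /
     (inner_g g p x x * inner_g g p y y - (inner_g g p x y)\<^sup>2)"

definition angle_g :: "('m \<Rightarrow> real^3^3) \<Rightarrow> 'm \<Rightarrow> real^3 \<Rightarrow> real^3 \<Rightarrow> real" where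
  "angle_g g p x y = arccos (inner_g g p x y / (sqrt (inner_g g p x x) * sqrt (inner_g g p y y)))"

section \<open>Circulant metric and circulant structure\<close>

definition circulant :: "real \<Rightarrow> real \<Rightarrow> real^3^3" where
  "circulant a b = vector [vector [a, b, b], vector [b, a, b], vector [b, b, a]]"

definition q_matrix :: "real^3^3" where
  "q_matrix = vector [vector [0, 1, 0], vector [0, 0, 1], vector [1, 0, 0]]"

text \<open>The lower index of \<open>q_i\<^sup>j\<close> is the row index and \<open>q e_i = \<Sum>j. q_i\<^sup>j e_j\<close>, hence
  \<open>(q x)\<^sup>j = \<Sum>i. x\<^sup>i q_i\<^sup>j\<close>, the product of a row vector with the matrix.\<close>

definition q :: "real^3 \<Rightarrow> real^3" where
  "q x = x v* q_matrix"

definition induces_q_basis :: "real^3 \<Rightarrow> bool" where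
  "induces_q_basis x \<longleftrightarrow> independent {x, q x, q (q x)} \<and> span {x, q x, q (q x)} = UNIV"

text \<open>The common value at \<open>p\<close> of \<open>sectional x (q x)\<close> over all vectors \<open>x\<close> that
  induce a \<open>q\<close>-basis and make the angle \<open>\<phi>\<close> with \<open>q x\<close>. The description denotes
  something only if such \<open>x\<close> exist and all of them give the same value.\<close>

definition mu ::
  "'m chart \<Rightarrow> ('m \<Rightarrow> real^3^3) \<Rightarrow> (('m \<Rightarrow> real^3) \<Rightarrow> ('m \<Rightarrow> real^3) \<Rightarrow> 'm \<Rightarrow> real^3) \<Rightarrow>
   'm \<Rightarrow> real \<Rightarrow> real" where
  "mu c g D p \<phi> = (THE m. \<exists>x. induces_q_basis x \<and> angle_g g p x (q x) = \<phi> \<and>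
     m = sectional c g D p x (q x))"

end

theory Submission
  imports Defs
begin

text \<open>Write \<open>P = x \<bullet> x\<close> and \<open>Q = x \<bullet> q x\<close> for the Euclidean products of the coordinate vectors. The
  curvature at \<open>p\<close> is alternating in the first and in the last two arguments, so it is a bilinear form
  on cross products. Invariance under \<open>q\<close> makes this form circulant, and evaluating it at
  \<open>x \<times> q x\<close> gives \<open>R(x, qx, x, qx) = (P - Q) (r P + s Q)\<close> with constants \<open>r, s\<close>.
  Both \<open>g(x, x)\<close> and \<open>g(x, qx)\<close> are linear in \<open>P, Q\<close>, and
  \<open>g(x, x) - g(x, qx)\<close> is proportional to \<open>P - Q\<close>. Hence
  \<open>\<mu>(\<phi>) = (\<alpha> + \<beta> cos \<phi>) / (1 + cos \<phi>)\<close>, and the values at \<open>\<pi>/2\<close> and \<open>\<pi>/3\<close> determine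
  \<open>\<alpha>\<close> and \<open>\<beta>\<close>.\<close>

section \<open>Symmetry of second derivatives\<close>

lemma has_real_derivative_along_line:
  fixes f :: "'a::real_normed_vector \<Rightarrow> real"
  assumes "f differentiable (at (a + s *\<^sub>R u))"
  shows "((\<lambda>s. f (a + s *\<^sub>R u)) has_real_derivative
    frechet_derivative f (at (a + s *\<^sub>R u)) u) (at s)"
proof -
  let ?F = "frechet_derivative f (at (a + s *\<^sub>R u))"
  have F: "(f has_derivative ?F) (at (a + s *\<^sub>R u))"
    using assms frechet_derivative_works by blast
  have "((\<lambda>s. a + s *\<^sub>R u) has_derivative (\<lambda>t. t *\<^sub>R u)) (at s)"
    by (auto intro!: derivative_eq_intros)
  from diff_chain_at[OF this F]
  have "((\<lambda>s. f (a + s *\<^sub>R u)) has_derivative (\<lambda>t. ?F (t *\<^sub>R u))) (at s)"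
    by (simp add: o_def)
  moreover have "?F (t *\<^sub>R u) = ?F u * t" for t
    using linear_cmul[OF has_derivative_linear[OF F]] by simp
  ultimately show ?thesis
    by (simp add: has_field_derivative_def)
qed

text \<open>The second difference over a parallelogram is evaluated by the mean value theorem twice,
  first in the direction \<open>u\<close>, then in the direction \<open>v\<close>.\<close>

lemma second_difference_mean_value:
  fixes f :: "'a::real_normed_vector \<Rightarrow> real"
  assumes h: "h > 0"
    and diff: "\<And>s t. 0 \<le> s \<Longrightarrow> s \<le> h \<Longrightarrow> 0 \<le> t \<Longrightarrow> t \<le> h \<Longrightarrow>
      f differentiable (at (p + s *\<^sub>R u + t *\<^sub>R v))"
    and diff_u: "\<And>s t. 0 \<le> s \<Longrightarrow> s \<le> h \<Longrightarrow> 0 \<le> t \<Longrightarrow> t \<le> h \<Longrightarrow>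
      (\<lambda>x. frechet_derivative f (at x) u) differentiable (at (p + s *\<^sub>R u + t *\<^sub>R v))"
  obtains s t where "0 \<le> s" "s \<le> h" "0 \<le> t" "t \<le> h"
    "f (p + h *\<^sub>R u + h *\<^sub>R v) - f (p + h *\<^sub>R u) - f (p + h *\<^sub>R v) + f p =
     h * h * frechet_derivative (\<lambda>x. frechet_derivative f (at x) u) (at (p + s *\<^sub>R u + t *\<^sub>R v)) v"
proof -
  let ?fu = "\<lambda>x. frechet_derivative f (at x) u"
  have line: "((\<lambda>s. f (p + s *\<^sub>R u + t *\<^sub>R v)) has_real_derivative ?fu (p + s *\<^sub>R u + t *\<^sub>R v)) (at s)"
    if "0 \<le> s" "s \<le> h" "0 \<le> t" "t \<le> h" for s t
    using has_real_derivative_along_line[of f "p + t *\<^sub>R v" s u] diff[OF that]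
    by (simp add: algebra_simps)
  \<comment> \<open>The function of \<open>s\<close> is the difference of \<open>f\<close> along the
    opposite sides \<open>t = h\<close> and \<open>t = 0\<close>. The zero terms keep every point in
    the form treated by \<open>line\<close>.\<close>
  have "\<exists>s>0. s < h \<and> (f (p + h *\<^sub>R u + h *\<^sub>R v) - f (p + h *\<^sub>R u + 0 *\<^sub>R v))
      - (f (p + 0 *\<^sub>R u + h *\<^sub>R v) - f (p + 0 *\<^sub>R u + 0 *\<^sub>R v)) =
      (h - 0) * (?fu (p + s *\<^sub>R u + h *\<^sub>R v) - ?fu (p + s *\<^sub>R u + 0 *\<^sub>R v))"
    using h by (intro MVT2 DERIV_diff line) auto
  then obtain s where s: "0 < s" "s < h" and
    1: "f (p + h *\<^sub>R u + h *\<^sub>R v) - f (p + h *\<^sub>R u) - f (p + h *\<^sub>R v) + f p =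
      h * (?fu (p + s *\<^sub>R u + h *\<^sub>R v) - ?fu (p + s *\<^sub>R u + 0 *\<^sub>R v))"
    by (auto simp: algebra_simps)
  have "\<exists>t>0. t < h \<and> ?fu (p + s *\<^sub>R u + h *\<^sub>R v) - ?fu (p + s *\<^sub>R u + 0 *\<^sub>R v) =
      (h - 0) * frechet_derivative ?fu (at (p + s *\<^sub>R u + t *\<^sub>R v)) v"
    using h s by (intro MVT2 has_real_derivative_along_line diff_u) auto
  then obtain t where "0 < t" "t < h" and
    2: "?fu (p + s *\<^sub>R u + h *\<^sub>R v) - ?fu (p + s *\<^sub>R u + 0 *\<^sub>R v) =
      h * frechet_derivative ?fu (at (p + s *\<^sub>R u + t *\<^sub>R v)) v"
    by auto
  then show thesis
    using that[of s t] s 1 unfolding 2 by (simp add: mult.assoc)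
qed

text \<open>The second difference of \<open>f\<close> is unchanged when \<open>u\<close> and
  \<open>v\<close> are swapped, so the two mixed derivatives agree at a pair of points arbitrarily
  close to \<open>p\<close>; continuity carries this to \<open>p\<close>.\<close>

lemma second_derivative_symmetric:
  fixes f :: "'a::real_normed_vector \<Rightarrow> real"
  assumes S: "open S" "p \<in> S"
    and diff: "\<And>x. x \<in> S \<Longrightarrow> f differentiable (at x)"
    and diff_u: "\<And>x. x \<in> S \<Longrightarrow> (\<lambda>x. frechet_derivative f (at x) u) differentiable (at x)"
    and diff_v: "\<And>x. x \<in> S \<Longrightarrow> (\<lambda>x. frechet_derivative f (at x) v) differentiable (at x)"
    and cont_uv: "continuous_on S
      (\<lambda>x. frechet_derivative (\<lambda>x. frechet_derivative f (at x) u) (at x) v)"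
    and cont_vu: "continuous_on S
      (\<lambda>x. frechet_derivative (\<lambda>x. frechet_derivative f (at x) v) (at x) u)"
  shows "frechet_derivative (\<lambda>x. frechet_derivative f (at x) u) (at p) v =
    frechet_derivative (\<lambda>x. frechet_derivative f (at x) v) (at p) u" (is "?uv p = ?vu p")
proof -
  have "\<bar>?uv p - ?vu p\<bar> \<le> e" if e: "e > 0" for e :: real
  proof -
    have "e / 2 > 0" using e by simp
    obtain d1 where d1: "d1 > 0" "\<And>x. x \<in> S \<Longrightarrow> dist x p < d1 \<Longrightarrow> dist (?uv x) (?uv p) < e / 2"
      using cont_uv S \<open>e / 2 > 0\<close> unfolding continuous_on_iff by metis
    obtain d2 where d2: "d2 > 0" "\<And>x. x \<in> S \<Longrightarrow> dist x p < d2 \<Longrightarrow> dist (?vu x) (?vu p) < e / 2"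
      using cont_vu S \<open>e / 2 > 0\<close> unfolding continuous_on_iff by metis
    obtain d3 where d3: "d3 > 0" "ball p d3 \<subseteq> S"
      using S open_contains_ball by blast
    define d where "d = min d1 (min d2 d3)"
    \<comment> \<open>With this \<open>K\<close>, every point of the parallelogram of side parameter
      \<open>h\<close> lies within \<open>d / 2\<close> of \<open>p\<close>. The summand 1 keeps
      \<open>K\<close> positive when \<open>u\<close> and \<open>v\<close> both vanish.\<close>
    define K where "K = norm u + norm v + 1"
    define h where "h = d / (2 * K)"
    have K: "K > 0" unfolding K_def using norm_ge_zero[of u] norm_ge_zero[of v] by linarith
    have d: "d > 0" using d1 d2 d3 by (simp add: d_def)
    have h: "h > 0" using d K by (simp add: h_def)
    have near: "dist (p + s *\<^sub>R u + t *\<^sub>R v) p < d"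
      if "0 \<le> s" "s \<le> h" "0 \<le> t" "t \<le> h" for s t
    proof -
      have "dist (p + s *\<^sub>R u + t *\<^sub>R v) p = norm (s *\<^sub>R u + t *\<^sub>R v)"
        by (simp add: dist_norm algebra_simps)
      also have "\<dots> \<le> s * norm u + t * norm v"
        using that by (intro order_trans[OF norm_triangle_ineq]) simp
      also have "\<dots> \<le> h * norm u + h * norm v"
        using that by (intro add_mono mult_right_mono) auto
      also have "\<dots> \<le> h * K" using h by (simp add: K_def algebra_simps)
      also have "\<dots> = d / 2" using K by (simp add: h_def)
      also have "\<dots> < d" using d by simp
      finally show ?thesis .
    qed
    have in_S: "p + s *\<^sub>R u + t *\<^sub>R v \<in> S"
      if "0 \<le> s" "s \<le> h" "0 \<le> t" "t \<le> h" for s t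
      using near[OF that] d3(2) by (auto simp: d_def dist_commute)
    have in_S': "p + t *\<^sub>R v + s *\<^sub>R u \<in> S"
      if "0 \<le> s" "s \<le> h" "0 \<le> t" "t \<le> h" for s t
      using in_S[OF that] by (simp add: algebra_simps)
    obtain s t where st: "0 \<le> s" "s \<le> h" "0 \<le> t" "t \<le> h" and
      1: "f (p + h *\<^sub>R u + h *\<^sub>R v) - f (p + h *\<^sub>R u) - f (p + h *\<^sub>R v) + f p =
        h * h * ?uv (p + s *\<^sub>R u + t *\<^sub>R v)"
      using second_difference_mean_value[OF h diff[OF in_S] diff_u[OF in_S]] by blast
    obtain t' s' where st': "0 \<le> s'" "s' \<le> h" "0 \<le> t'" "t' \<le> h" and
      2: "f (p + h *\<^sub>R v + h *\<^sub>R u) - f (p + h *\<^sub>R v) - f (p + h *\<^sub>R u) + f p =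
        h * h * ?vu (p + t' *\<^sub>R v + s' *\<^sub>R u)"
      using second_difference_mean_value[OF h diff[OF in_S'] diff_v[OF in_S']] by blast
    have "h * h * ?uv (p + s *\<^sub>R u + t *\<^sub>R v) = h * h * ?vu (p + s' *\<^sub>R u + t' *\<^sub>R v)"
      using 1 2 by (simp add: algebra_simps)
    then have "?uv (p + s *\<^sub>R u + t *\<^sub>R v) = ?vu (p + s' *\<^sub>R u + t' *\<^sub>R v)"
      using h by simp
    moreover have "dist (?uv (p + s *\<^sub>R u + t *\<^sub>R v)) (?uv p) < e / 2"
      using near[OF st] d1(2)[OF in_S[OF st]] by (simp add: d_def)
    moreover have "dist (?vu (p + s' *\<^sub>R u + t' *\<^sub>R v)) (?vu p) < e / 2"
      using near[OF st'] d2(2)[OF in_S[OF st']] by (simp add: d_def)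
    ultimately show ?thesis unfolding dist_real_def by linarith
  qed
  then have "\<bar>?uv p - ?vu p\<bar> \<le> 0" by (rule field_le_epsilon[of _ 0, simplified])
  then show ?thesis by simp
qed

section \<open>Partial derivatives and functions of class \<open>C_on\<close>\<close>

text \<open>\<open>frechet_derivative\<close> is a choice among all derivatives. Functions agreeing
  near \<open>x\<close> have the same derivatives there, so the choices coincide, even where none
  exists.\<close>

lemma partial_cong:
  assumes "open S" "x \<in> S" "\<And>y. y \<in> S \<Longrightarrow> f y = g y"
  shows "partial i f x = partial i g x"
proof -
  have "(f has_derivative F) (at x) \<longleftrightarrow> (g has_derivative F) (at x)" for F
    using has_derivative_transform_within_open[OF _ assms(1,2)] assms(3) by metis
  then show ?thesis by (simp add: partial_def frechet_derivative_def)
qed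

lemma partial_const [simp]: "partial i (\<lambda>_. a) x = 0"
  by (simp add: partial_def)

lemma partial_linear_combination:
  assumes "f differentiable (at x)" "g differentiable (at x)"
  shows "partial i (\<lambda>x. a * f x + b * g x) x = a * partial i f x + b * partial i g x"
proof -
  have "((\<lambda>x. a * f x + b * g x) has_derivative
      (\<lambda>h. a * frechet_derivative f (at x) h + b * frechet_derivative g (at x) h)) (at x)"
    using assms by (auto intro!: derivative_eq_intros simp: frechet_derivative_works[symmetric])
  from fun_cong[OF frechet_derivative_at[OF this], of "axis i 1"] show ?thesis
    by (simp add: partial_def)
qed

lemma C_on_cong:
  assumes "open S" "\<And>x. x \<in> S \<Longrightarrow> f x = g x" "C_on k S f"
  shows "C_on k S g"
  using assms(2,3)
proof (induction k arbitrary: f g)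
  case 0
  then show ?case by (simp cong: continuous_on_cong)
next
  case (Suc k)
  have "g differentiable (at x)" if x: "x \<in> S" for x
  proof -
    obtain F where "(f has_derivative F) (at x)"
      using Suc.prems(2) x by (auto simp: differentiable_def)
    from has_derivative_transform_within_open[OF this assms(1) x Suc.prems(1)]
    show ?thesis by (auto simp: differentiable_def)
  qed
  moreover have "C_on k S (partial i g)" for i
    by (rule Suc.IH[of "partial i f"], rule partial_cong[OF assms(1)]) (use Suc.prems in simp_all)
  ultimately show ?case by simp
qed

lemma C_on_const: "C_on k S (\<lambda>_. a)"
proof (induction k arbitrary: a)
  case (Suc k)
  have "partial i (\<lambda>_. a) = (\<lambda>_. 0)" for i by (simp add: fun_eq_iff)
  then show ?case using Suc by simp
qed simp

lemma C_on_linear_combination: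
  assumes "open S" "C_on k S f" "C_on k S g"
  shows "C_on k S (\<lambda>x. a * f x + b * g x)"
  using assms(2,3)
proof (induction k arbitrary: f g)
  case 0
  then show ?case by (auto intro!: continuous_intros)
next
  case (Suc k)
  have "C_on k S (partial i (\<lambda>x. a * f x + b * g x))" for i
    by (rule C_on_cong[OF assms(1), of "\<lambda>x. a * partial i f x + b * partial i g x"])
      (use Suc in \<open>auto simp: partial_linear_combination\<close>)
  then show ?case using Suc.prems by auto
qed

lemma partial_commute:
  assumes "open S" "x \<in> S" "C_on 2 S f"
  shows "partial i (partial j f) x = partial j (partial i f) x"
proof -
  have partial_eq: "(\<lambda>x. frechet_derivative h (at x) (axis k 1)) = partial k h" for h k
    by (simp add: fun_eq_iff partial_def)
  have C2: "C_on (Suc (Suc 0)) S f" using assms(3) by (simp add: numeral_2_eq_2)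
  show ?thesis
    using second_derivative_symmetric[OF assms(1,2), of f "axis j 1" "axis i 1"] C2
    unfolding partial_eq by (simp add: partial_def)
qed

lemma partial_sum:
  fixes f :: "'i::finite \<Rightarrow> real^3 \<Rightarrow> real"
  assumes "\<And>j. f j differentiable (at x)"
  shows "partial i (\<lambda>x. \<Sum>j\<in>UNIV. a j * f j x) x = (\<Sum>j\<in>UNIV. a j * partial i (f j) x)"
proof -
  have "((\<lambda>x. \<Sum>j\<in>UNIV. a j * f j x) has_derivative
      (\<lambda>h. \<Sum>j\<in>UNIV. a j * frechet_derivative (f j) (at x) h)) (at x)"
    using assms by (auto intro!: has_derivative_sum has_derivative_mult_right
      simp: frechet_derivative_works[symmetric])
  from fun_cong[OF frechet_derivative_at[OF this], of "axis i 1"] show ?thesis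
    by (simp add: partial_def)
qed

section \<open>The curvature of an affine connection on a chart\<close>

lemma chart_inv_apply: "inj_on (snd c) (fst c) \<Longrightarrow> p \<in> fst c \<Longrightarrow> chart_inv c (snd c p) = p"
  by (simp add: chart_inv_def)

lemma chart_inv_in_domain: "x \<in> snd c ` fst c \<Longrightarrow> chart_inv c x \<in> fst c"
  by (simp add: chart_inv_def inv_into_into)

lemma smooth_fun_const: "smooth_fun c (\<lambda>_. a)"
  by (simp add: smooth_fun_def smooth_on_def o_def C_on_const)

lemma smooth_field_const: "smooth_field c (\<lambda>_. x)"
  by (simp add: smooth_field_def smooth_fun_const)

lemma dir_deriv_const: "dir_deriv c X (\<lambda>_. a) p = 0"
  by (simp add: dir_deriv_def o_def)

lemma lie_bracket_const: "lie_bracket c (\<lambda>_. x) (\<lambda>_. y) p = 0"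
  by (simp add: lie_bracket_def dir_deriv_const vec_eq_iff)

lemma curvature_linear_4:
  "curvature c g D p x y z (a *\<^sub>R w + b *\<^sub>R w') =
    a * curvature c g D p x y z w + b * curvature c g D p x y z w'"
  by (simp add: curvature_def inner_g_def matrix_vector_right_distrib inner_add_right
      scaleR_matrix_vector_assoc[symmetric] matrix_vector_mult_scaleR)

lemma inner_g_commute: "transpose (g p) = g p \<Longrightarrow> inner_g g p x y = inner_g g p y x"
  by (metis inner_g_def dot_lmul_matrix inner_commute transpose_matrix_vector)

context
  fixes c :: "'m chart"
  assumes open_image: "open (snd c ` fst c)"
begin

lemma smooth_fun_cong:
  assumes "\<And>p. p \<in> fst c \<Longrightarrow> f p = g p" "smooth_fun c f"
  shows "smooth_fun c g"
  using assms C_on_cong[OF open_image, of "f \<circ> chart_inv c" "g \<circ> chart_inv c"]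
  by (auto simp: smooth_fun_def smooth_on_def chart_inv_in_domain simp del: image_iff)

lemma smooth_fun_linear_combination:
  assumes "smooth_fun c f" "smooth_fun c g"
  shows "smooth_fun c (\<lambda>p. a * f p + b * g p)"
  using assms C_on_linear_combination[OF open_image]
  by (simp add: smooth_fun_def smooth_on_def o_def)

lemma smooth_field_linear_combination:
  assumes "smooth_field c X" "smooth_field c Y"
  shows "smooth_field c (\<lambda>p. a *\<^sub>R X p + b *\<^sub>R Y p)"
  using assms by (simp add: smooth_field_def smooth_fun_linear_combination)

lemma dir_deriv_cong:
  assumes "inj_on (snd c) (fst c)" "p \<in> fst c" "\<And>r. r \<in> fst c \<Longrightarrow> f r = g r"
  shows "dir_deriv c X f p = dir_deriv c X g p"
  unfolding dir_deriv_def
  using assms by (intro sum.cong refl arg_cong2[of _ _ _ _ "(*)"] partial_cong[OF open_image])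
    (auto simp: chart_inv_apply)

text \<open>Constant components contribute no first-order terms, so both sides are the same double
  sum of second partials up to the symmetry \<open>partial_commute\<close>.\<close>

lemma dir_deriv_const_fields_commute:
  assumes inj: "inj_on (snd c) (fst c)" and p: "p \<in> fst c" and f: "smooth_fun c f"
  shows "dir_deriv c (\<lambda>_. x) (dir_deriv c (\<lambda>_. y) f) p =
    dir_deriv c (\<lambda>_. y) (dir_deriv c (\<lambda>_. x) f) p"
proof -
  let ?h = "f \<circ> chart_inv c" and ?S = "snd c ` fst c"
  have pS: "snd c p \<in> ?S" using p by simp
  have C2: "C_on 2 ?S ?h" using f by (simp add: smooth_fun_def smooth_on_def)
  then have diff: "partial i ?h differentiable (at (snd c p))" for i
    using pS by (auto simp: numeral_2_eq_2)
  have second: "dir_deriv c (\<lambda>_. x) (dir_deriv c (\<lambda>_. y) f) p =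
      (\<Sum>j\<in>UNIV. \<Sum>i\<in>UNIV. x $ j * y $ i * partial j (partial i ?h) (snd c p))" for x y
  proof -
    have "partial j (dir_deriv c (\<lambda>_. y) f \<circ> chart_inv c) (snd c p) =
        partial j (\<lambda>z. \<Sum>i\<in>UNIV. y $ i * partial i ?h z) (snd c p)" for j
      by (rule partial_cong[OF open_image pS])
        (auto simp: dir_deriv_def chart_inv_apply[OF inj])
    also have "\<dots> j = (\<Sum>i\<in>UNIV. y $ i * partial j (partial i ?h) (snd c p))" for j
      by (rule partial_sum[OF diff])
    finally show ?thesis
      by (simp add: dir_deriv_def[of c "\<lambda>_. x"] sum_distrib_left mult.assoc)
  qed
  show ?thesis
    unfolding second by (subst sum.swap)
      (simp add: partial_commute[OF open_image pS C2] mult.commute)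
qed

section \<open>Linearity of the connection and of its curvature\<close>

context
  fixes D :: "('m \<Rightarrow> real^3) \<Rightarrow> ('m \<Rightarrow> real^3) \<Rightarrow> 'm \<Rightarrow> real^3"
  assumes conn: "affine_connection c D"
begin

lemma connection_smooth: "smooth_field c X \<Longrightarrow> smooth_field c Y \<Longrightarrow> smooth_field c (D X Y)"
  using conn by (simp add: affine_connection_def)

lemma connection_linear_left:
  assumes "smooth_field c X" "smooth_field c Y" "smooth_field c Z" "p \<in> fst c"
  shows "D (\<lambda>r. a *\<^sub>R X r + b *\<^sub>R Y r) Z p = a *\<^sub>R D X Z p + b *\<^sub>R D Y Z p"
proof -
  have scale: "smooth_field c (\<lambda>r. a *\<^sub>R X r)" if "smooth_field c X" for a X
    using smooth_field_linear_combination[OF that that, of a 0] by simp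
  have "D (\<lambda>r. a *\<^sub>R X r) Z p = a *\<^sub>R D X Z p" if "smooth_field c X" for a X
    using conn that assms smooth_fun_const[of c a] unfolding affine_connection_def by blast
  \<comment> \<open>In \<open>affine_connection\<close> additivity sits under the same quantifier as
    the rules with a scalar function \<open>f\<close>; the constant 0 instantiates that
    \<open>f\<close>.\<close>
  moreover have "D (\<lambda>r. a *\<^sub>R X r + b *\<^sub>R Y r) Z p =
      D (\<lambda>r. a *\<^sub>R X r) Z p + D (\<lambda>r. b *\<^sub>R Y r) Z p"
    using conn assms(3,4) scale[OF assms(1), of a] scale[OF assms(2), of b] smooth_fun_const[of c 0]
    unfolding affine_connection_def by blast
  ultimately show ?thesis using assms by simp
qed

text \<open>This is the Leibniz rule with constant coefficients, whose derivative terms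
  vanish.\<close>

lemma connection_linear_right:
  assumes "smooth_field c X" "smooth_field c Y" "smooth_field c Z" "p \<in> fst c"
  shows "D X (\<lambda>r. a *\<^sub>R Y r + b *\<^sub>R Z r) p = a *\<^sub>R D X Y p + b *\<^sub>R D X Z p"
proof -
  have scale: "smooth_field c (\<lambda>r. a *\<^sub>R Y r)" if "smooth_field c Y" for a Y
    using smooth_field_linear_combination[OF that that, of a 0] by simp
  have "D X (\<lambda>r. a *\<^sub>R Y r) p = dir_deriv c X (\<lambda>_. a) p *\<^sub>R Y p + a *\<^sub>R D X Y p"
    if "smooth_field c Y" for a Y
    using conn that assms smooth_fun_const[of c a] unfolding affine_connection_def by blast
  then have "D X (\<lambda>r. a *\<^sub>R Y r) p = a *\<^sub>R D X Y p" if "smooth_field c Y" for a Y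
    using that by (simp add: dir_deriv_const)
  moreover have "D X (\<lambda>r. a *\<^sub>R Y r + b *\<^sub>R Z r) p =
      D X (\<lambda>r. a *\<^sub>R Y r) p + D X (\<lambda>r. b *\<^sub>R Z r) p"
    using conn assms(1,4) scale[OF assms(2), of a] scale[OF assms(3), of b] smooth_fun_const[of c 0]
    unfolding affine_connection_def by blast
  ultimately show ?thesis using assms by simp
qed

text \<open>A field vanishing on the chart domain equals its product with the indicator function of the
  complement, which is smooth there; the Leibniz rule then makes the connection local.\<close>

lemma connection_cong_right:
  assumes X: "smooth_field c X" and Y: "smooth_field c Y" and Z: "smooth_field c Z"
    and p: "p \<in> fst c" and eq: "\<And>r. r \<in> fst c \<Longrightarrow> Y r = Z r"
  shows "D X Y p = D X Z p"
proof -
  define V where "V = (\<lambda>r. 1 *\<^sub>R Y r + (- 1) *\<^sub>R Z r)"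
  define f :: "'m \<Rightarrow> real" where "f = (\<lambda>r. if r \<in> fst c then 0 else 1)"
  have V: "smooth_field c V"
    unfolding V_def by (rule smooth_field_linear_combination[OF Y Z])
  have f: "smooth_fun c f"
    by (rule smooth_fun_cong[OF _ smooth_fun_const[of c 0]]) (simp add: f_def)
  have "(\<lambda>r. f r *\<^sub>R V r) = V"
    by (auto simp: f_def V_def eq)
  moreover have "D X (\<lambda>r. f r *\<^sub>R V r) p = dir_deriv c X f p *\<^sub>R V p + f p *\<^sub>R D X V p"
    using conn X V f p unfolding affine_connection_def by blast
  ultimately have "D X V p = 0"
    using p by (simp add: f_def V_def eq)
  moreover have "D X V p = 1 *\<^sub>R D X Y p + (- 1) *\<^sub>R D X Z p"
    unfolding V_def by (rule connection_linear_right[OF X Y Z p])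
  ultimately show ?thesis by simp
qed

text \<open>Constant fields have zero Lie bracket, and the connection vanishes in the direction of
  the zero field.\<close>

lemma curvature_op_const:
  assumes "p \<in> fst c"
  shows "curvature_op c D (\<lambda>_. x) (\<lambda>_. y) (\<lambda>_. z) p =
    D (\<lambda>_. x) (D (\<lambda>_. y) (\<lambda>_. z)) p - D (\<lambda>_. y) (D (\<lambda>_. x) (\<lambda>_. z)) p"
proof -
  have "lie_bracket c (\<lambda>_. x) (\<lambda>_. y) = (\<lambda>_. 0)"
    by (simp add: fun_eq_iff lie_bracket_const)
  moreover have "D (\<lambda>_. 0) (\<lambda>_. z) p = 0"
    using connection_linear_left[OF smooth_field_const smooth_field_const smooth_field_const assms,
        of 0 _ 0] by simp
  ultimately show ?thesis by (simp add: curvature_op_def)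
qed

lemma curvature_antisym_12:
  assumes "p \<in> fst c"
  shows "curvature c g D p y x z w = - curvature c g D p x y z w"
  by (simp add: curvature_def curvature_op_const[OF assms] inner_g_def inner_diff_left)

text \<open>The inner covariant derivative is known to be linear only at points of the chart domain,
  so locality (\<open>connection_cong_right\<close>) is what lets the outer one act on the expanded
  field.\<close>

lemma curvature_linear_1:
  assumes p: "p \<in> fst c"
  shows "curvature c g D p (a *\<^sub>R x + b *\<^sub>R x') y z w =
    a * curvature c g D p x y z w + b * curvature c g D p x' y z w"
proof -
  note sc = smooth_field_const and sm = connection_smooth[OF smooth_field_const smooth_field_const]
  have "D (\<lambda>_. y) (D (\<lambda>_. a *\<^sub>R x + b *\<^sub>R x') (\<lambda>_. z)) p =
      D (\<lambda>_. y) (\<lambda>r. a *\<^sub>R D (\<lambda>_. x) (\<lambda>_. z) r + b *\<^sub>R D (\<lambda>_. x') (\<lambda>_. z) r) p"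
    by (rule connection_cong_right[OF sc sm smooth_field_linear_combination[OF sm sm] p
          connection_linear_left[OF sc sc sc]])
  also have "\<dots> = a *\<^sub>R D (\<lambda>_. y) (D (\<lambda>_. x) (\<lambda>_. z)) p + b *\<^sub>R D (\<lambda>_. y) (D (\<lambda>_. x') (\<lambda>_. z)) p"
    by (rule connection_linear_right[OF sc sm sm p])
  finally show ?thesis
    using connection_linear_left[OF sc sc sm p, of a x b x' y z]
    by (simp add: curvature_def curvature_op_const[OF p] inner_g_def algebra_simps
        inner_add_left inner_diff_left)
qed

lemma curvature_linear_3:
  assumes p: "p \<in> fst c"
  shows "curvature c g D p x y (a *\<^sub>R z + b *\<^sub>R z') w =
    a * curvature c g D p x y z w + b * curvature c g D p x y z' w"
proof -
  note sc = smooth_field_const and sm = connection_smooth[OF smooth_field_const smooth_field_const]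
  have "D (\<lambda>_. x) (D (\<lambda>_. y) (\<lambda>_. a *\<^sub>R z + b *\<^sub>R z')) p =
      a *\<^sub>R D (\<lambda>_. x) (D (\<lambda>_. y) (\<lambda>_. z)) p + b *\<^sub>R D (\<lambda>_. x) (D (\<lambda>_. y) (\<lambda>_. z')) p" for x y
  proof -
    have "D (\<lambda>_. x) (D (\<lambda>_. y) (\<lambda>_. a *\<^sub>R z + b *\<^sub>R z')) p =
        D (\<lambda>_. x) (\<lambda>r. a *\<^sub>R D (\<lambda>_. y) (\<lambda>_. z) r + b *\<^sub>R D (\<lambda>_. y) (\<lambda>_. z') r) p"
      by (rule connection_cong_right[OF sc sm smooth_field_linear_combination[OF sm sm] p
            connection_linear_right[OF sc sc sc]])
    also have "\<dots> = a *\<^sub>R D (\<lambda>_. x) (D (\<lambda>_. y) (\<lambda>_. z)) p + b *\<^sub>R D (\<lambda>_. x) (D (\<lambda>_. y) (\<lambda>_. z')) p"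
      by (rule connection_linear_right[OF sc sm sm p])
    finally show ?thesis .
  qed
  then show ?thesis
    by (simp add: curvature_def curvature_op_const[OF p] inner_g_def algebra_simps
        inner_add_left inner_diff_left)
qed

end

text \<open>By metric compatibility the left-hand side is half the commutator of second derivatives of
  the function \<open>g(z, z)\<close>.\<close>

lemma levi_civita_curvature_diagonal:
  assumes inj: "inj_on (snd c) (fst c)" and LC: "levi_civita c g D" and p: "p \<in> fst c"
    and sym: "\<And>r. r \<in> fst c \<Longrightarrow> transpose (g r) = g r"
    and smooth: "smooth_fun c (\<lambda>r. inner_g g r z z)"
  shows "curvature c g D p x y z z = 0"
proof -
  have conn: "affine_connection c D" using LC by (simp add: levi_civita_def)
  note sc = smooth_field_const and sm = connection_smooth[OF conn sc sc]
  let ?H = "\<lambda>r. inner_g g r z z"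
  have compat: "dir_deriv c X (\<lambda>r. inner_g g r (Y r) (Z r)) r =
      inner_g g r (D X Y r) (Z r) + inner_g g r (Y r) (D X Z r)"
    if "smooth_field c X" "smooth_field c Y" "smooth_field c Z" "r \<in> fst c" for X Y Z r
    using LC that by (simp add: levi_civita_def)
  have half: "2 * inner_g g p (D (\<lambda>_. x) (D (\<lambda>_. y) (\<lambda>_. z)) p) z +
      2 * inner_g g p (D (\<lambda>_. y) (\<lambda>_. z) p) (D (\<lambda>_. x) (\<lambda>_. z) p) =
      dir_deriv c (\<lambda>_. x) (dir_deriv c (\<lambda>_. y) ?H) p" for x y
  proof -
    \<comment> \<open>The padding by \<open>0 *\<^sub>R 0\<close> gives the two-term shape of the
      linearity rules for smooth fields and for \<open>D\<close>.\<close>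
    have "dir_deriv c (\<lambda>_. y) ?H r = inner_g g r (2 *\<^sub>R D (\<lambda>_. y) (\<lambda>_. z) r + 0 *\<^sub>R 0) z"
      if "r \<in> fst c" for r
      using compat[OF sc sc sc that, of y z z] inner_g_commute[of g r z, OF sym[OF that]]
      by (simp add: inner_g_def)
    then have "dir_deriv c (\<lambda>_. x) (dir_deriv c (\<lambda>_. y) ?H) p =
        dir_deriv c (\<lambda>_. x) (\<lambda>r. inner_g g r (2 *\<^sub>R D (\<lambda>_. y) (\<lambda>_. z) r + 0 *\<^sub>R 0) z) p"
      by (rule dir_deriv_cong[OF inj p])
    also have "\<dots> = inner_g g p (D (\<lambda>_. x) (\<lambda>r. 2 *\<^sub>R D (\<lambda>_. y) (\<lambda>_. z) r + 0 *\<^sub>R 0) p) z +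
        inner_g g p (2 *\<^sub>R D (\<lambda>_. y) (\<lambda>_. z) p + 0 *\<^sub>R 0) (D (\<lambda>_. x) (\<lambda>_. z) p)"
      by (rule compat[OF sc smooth_field_linear_combination[OF sm sc] sc p])
    also have "D (\<lambda>_. x) (\<lambda>r. 2 *\<^sub>R D (\<lambda>_. y) (\<lambda>_. z) r + 0 *\<^sub>R 0) p =
        2 *\<^sub>R D (\<lambda>_. x) (D (\<lambda>_. y) (\<lambda>_. z)) p + 0 *\<^sub>R D (\<lambda>_. x) (\<lambda>_. 0) p"
      by (rule connection_linear_right[OF conn sc sm sc p])
    finally show ?thesis by (simp add: inner_g_def)
  qed
  \<comment> \<open>Subtracting the two instances of \<open>half\<close> cancels the product of
    first derivatives, which is symmetric in \<open>x\<close> and \<open>y\<close>.\<close>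
  have "2 * curvature c g D p x y z z = 0"
    using half[of x y] half[of y x] dir_deriv_const_fields_commute[OF inj p smooth, of x y]
      inner_g_commute[of g p "D (\<lambda>_. x) (\<lambda>_. z) p", OF sym[OF p]]
    by (simp add: curvature_def curvature_op_const[OF conn p] inner_g_def inner_diff_left)
  then show ?thesis by simp
qed

end

section \<open>Circulant geometry of the tangent space\<close>

text \<open>An alternating bilinear form on three-space is a linear functional of the cross product.
  Linearity in the second argument follows from \<open>lin\<close> by antisymmetry.\<close>

lemma alternating_bilinear_expand:
  fixes T :: "real^3 \<Rightarrow> real^3 \<Rightarrow> real"
  assumes lin: "\<And>a b x x' y. T (a *\<^sub>R x + b *\<^sub>R x') y = a * T x y + b * T x' y"
    and anti: "\<And>x y. T y x = - T x y"
  shows "T x y = (x$1 * y$2 - x$2 * y$1) * T (axis 1 1) (axis 2 1)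
    + (x$2 * y$3 - x$3 * y$2) * T (axis 2 1) (axis 3 1)
    + (x$3 * y$1 - x$1 * y$3) * T (axis 3 1) (axis 1 1)"
proof -
  let ?e = "\<lambda>i. axis i 1 :: real^3"
  have decompose: "x = x$1 *\<^sub>R ?e 1 + 1 *\<^sub>R (x$2 *\<^sub>R ?e 2 + x$3 *\<^sub>R ?e 3)" for x
    by (simp add: vec_eq_iff forall_3 axis_def)
  have left: "T x y = x$1 * T (?e 1) y + x$2 * T (?e 2) y + x$3 * T (?e 3) y" for x y
    by (subst decompose[of x]) (simp only: lin, simp)
  have right: "T x y = y$1 * T x (?e 1) + y$2 * T x (?e 2) + y$3 * T x (?e 3)" for x y
    using left[of y x] anti[of x y] anti[of x "?e 1"] anti[of x "?e 2"] anti[of x "?e 3"]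
    by (simp add: algebra_simps)
  have diag: "T x x = 0" for x using anti[of x x] by simp
  show ?thesis
    unfolding left[of x y] right[of "?e 1" y] right[of "?e 2" y] right[of "?e 3" y] diag
    using anti[of "?e 1" "?e 2"] anti[of "?e 2" "?e 3"] anti[of "?e 3" "?e 1"]
    by (simp add: algebra_simps)
qed

lemma q_component: "q x $ 1 = x $ 3" "q x $ 2 = x $ 1" "q x $ 3 = x $ 2"
  by (simp_all add: q_def q_matrix_def vector_matrix_mult_def sum_3)

lemma q_axis: "q (axis 1 1) = axis 2 1" "q (axis 2 1) = axis 3 1" "q (axis 3 1) = axis 1 1"
  by (simp_all add: vec_eq_iff forall_3 q_component axis_def)

lemma inner_3: "x \<bullet> y = x$1 * y$1 + x$2 * y$2 + x$3 * y$3" for x y :: "real^3"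
  by (simp add: inner_vec_def sum_3)

text \<open>\<open>q\<close> permutes the coordinate planes cyclically, so the form on cross
  products has a circulant matrix with entries \<open>?a\<close>, \<open>?b\<close>,
  \<open>?b'\<close>. For \<open>w = x \<times> q x\<close>, \<open>P = x \<bullet> x\<close> and
  \<open>Q = x \<bullet> q x\<close> one has \<open>w \<bullet> w = P * P - Q * Q\<close> and
  \<open>w \<bullet> q w = - Q * (P - Q)\<close>, which yields the factor
  \<open>P - Q\<close>.\<close>

lemma q_invariant_curvature_form:
  fixes R :: "real^3 \<Rightarrow> real^3 \<Rightarrow> real^3 \<Rightarrow> real^3 \<Rightarrow> real"
  assumes lin1: "\<And>a b x x' y z w. R (a *\<^sub>R x + b *\<^sub>R x') y z w = a * R x y z w + b * R x' y z w"
    and anti12: "\<And>x y z w. R y x z w = - R x y z w"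
    and lin3: "\<And>a b x y z z' w. R x y (a *\<^sub>R z + b *\<^sub>R z') w = a * R x y z w + b * R x y z' w"
    and anti34: "\<And>x y z w. R x y w z = - R x y z w"
    and inv: "\<And>x y z w. R (q x) (q y) (q z) (q w) = R x y z w"
  obtains a b where
    "\<And>x. R x (q x) x (q x) = (x \<bullet> x - x \<bullet> q x) * (a * (x \<bullet> x) + b * (x \<bullet> q x))"
proof -
  let ?e = "\<lambda>i. axis i 1 :: real^3"
  let ?a = "R (?e 1) (?e 2) (?e 1) (?e 2)" and ?b = "R (?e 1) (?e 2) (?e 2) (?e 3)"
    and ?b' = "R (?e 1) (?e 2) (?e 3) (?e 1)"
  note expand12 = alternating_bilinear_expand[where T = "\<lambda>x y. R x y z w" for z w, OF lin1 anti12]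
  have expand34: "R s t z w = (z$1 * w$2 - z$2 * w$1) * R s t (axis 1 1) (axis 2 1)
    + (z$2 * w$3 - z$3 * w$2) * R s t (axis 2 1) (axis 3 1)
    + (z$3 * w$1 - z$1 * w$3) * R s t (axis 3 1) (axis 1 1)" for s t z w
    by (rule alternating_bilinear_expand[OF lin3 anti34])
  \<comment> \<open>One or two applications of \<open>q\<close> move each coefficient back to one
    whose first plane is spanned by \<open>?e 1\<close> and \<open>?e 2\<close>.\<close>
  have shift: "R (?e 2) (?e 3) (?e 2) (?e 3) = ?a" "R (?e 3) (?e 1) (?e 3) (?e 1) = ?a"
    "R (?e 2) (?e 3) (?e 3) (?e 1) = ?b" "R (?e 3) (?e 1) (?e 1) (?e 2) = ?b"
    "R (?e 2) (?e 3) (?e 1) (?e 2) = ?b'" "R (?e 3) (?e 1) (?e 2) (?e 3) = ?b'"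
    using inv[of "?e 1" "?e 2" "?e 1" "?e 2"] inv[of "?e 2" "?e 3" "?e 2" "?e 3"]
      inv[of "?e 1" "?e 2" "?e 2" "?e 3"] inv[of "?e 2" "?e 3" "?e 3" "?e 1"]
      inv[of "?e 1" "?e 2" "?e 3" "?e 1"] inv[of "?e 2" "?e 3" "?e 1" "?e 2"]
    by (simp_all add: q_axis)
  have "R x (q x) x (q x) =
      (x \<bullet> x - x \<bullet> q x) * (?a * (x \<bullet> x) + (?a - ?b - ?b') * (x \<bullet> q x))" for x
  proof -
    define w1 w2 w3 where w: "w1 = x$1 * q x$2 - x$2 * q x$1" "w2 = x$2 * q x$3 - x$3 * q x$2"
      "w3 = x$3 * q x$1 - x$1 * q x$3"
    have "R x (q x) x (q x) =
        w1 * R (?e 1) (?e 2) x (q x) + w2 * R (?e 2) (?e 3) x (q x) + w3 * R (?e 3) (?e 1) x (q x)"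
      unfolding w by (rule expand12)
    also have "R (?e 1) (?e 2) x (q x) = w1 * ?a + w2 * ?b + w3 * ?b'"
      unfolding w by (rule expand34)
    also have "R (?e 2) (?e 3) x (q x) = w1 * ?b' + w2 * ?a + w3 * ?b"
      using expand34[of "?e 2" "?e 3" x "q x"] by (simp only: shift w)
    also have "R (?e 3) (?e 1) x (q x) = w1 * ?b + w2 * ?b' + w3 * ?a"
      using expand34[of "?e 3" "?e 1" x "q x"] by (simp only: shift w)
    also have "w1 * (w1 * ?a + w2 * ?b + w3 * ?b') + w2 * (w1 * ?b' + w2 * ?a + w3 * ?b) +
        w3 * (w1 * ?b + w2 * ?b' + w3 * ?a) =
        ?a * (w1 * w1 + w2 * w2 + w3 * w3) + (?b + ?b') * (w1 * w2 + w2 * w3 + w3 * w1)"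
      by algebra
    also have "\<dots> = (x \<bullet> x - x \<bullet> q x) * (?a * (x \<bullet> x) + (?a - ?b - ?b') * (x \<bullet> q x))"
      unfolding w inner_3 q_component by algebra
    finally show ?thesis .
  qed
  then show thesis by (rule that)
qed

section \<open>Circulant metric, q-bases and angles\<close>

text \<open>The matrix is \<open>a - b\<close> times the identity plus \<open>b\<close> times the
  all-ones matrix, and \<open>x \<bullet> q x\<close> is the sum of the products of distinct
  coordinates. \<open>q\<close> permutes coordinates, hence is an isometry.\<close>

lemma inner_g_circulant:
  assumes "g p = circulant a b"
  shows "inner_g g p x x = a * (x \<bullet> x) + 2 * b * (x \<bullet> q x)"
    and "inner_g g p x (q x) = b * (x \<bullet> x) + (a + b) * (x \<bullet> q x)"
    and "inner_g g p (q x) (q x) = inner_g g p x x"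
  unfolding inner_g_def assms inner_3 q_component
  by (simp_all add: circulant_def matrix_vector_mult_def sum_3 q_component algebra_simps)

lemma transpose_circulant: "transpose (circulant a b) = circulant a b"
  by (simp add: transpose_def circulant_def vec_eq_iff forall_3)

text \<open>The determinant of \<open>x\<close>, \<open>q x\<close>, \<open>q (q x)\<close> is
  circulant and factors as the coordinate sum times \<open>x \<bullet> x - x \<bullet> q x\<close>,
  the number \<open>d\<close> of the proof.\<close>

lemma induces_q_basisI:
  assumes s: "x$1 + x$2 + x$3 \<noteq> 0" and ne: "x \<bullet> x \<noteq> x \<bullet> q x"
  shows "induces_q_basis x"
proof -
  let ?B = "{x, q x, q (q x)}"
  define d where "d = (x$1 + x$2 + x$3) * (x \<bullet> x - x \<bullet> q x)"
  have d: "d \<noteq> 0" using assms by (simp add: d_def)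
  have "v \<in> span ?B" for v
  proof -
    \<comment> \<open>These are the cofactors of the circulant matrix; Cramer's rule then writes
      \<open>d *\<^sub>R v\<close> in the three vectors.\<close>
    define a1 a2 a3 where a: "a1 = (x$1)\<^sup>2 - x$2 * x$3" "a2 = (x$2)\<^sup>2 - x$1 * x$3"
      "a3 = (x$3)\<^sup>2 - x$1 * x$2"
    have "d *\<^sub>R v = (v$1 * a1 + v$2 * a2 + v$3 * a3) *\<^sub>R x +
        (v$1 * a3 + v$2 * a1 + v$3 * a2) *\<^sub>R q x + (v$1 * a2 + v$2 * a3 + v$3 * a1) *\<^sub>R q (q x)"
      unfolding vec_eq_iff forall_3 d_def a inner_3
      by (simp add: q_component, intro conjI; algebra)
    also have "\<dots> \<in> span ?B"
      by (intro span_add span_scale span_base) auto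
    finally have "inverse d *\<^sub>R d *\<^sub>R v \<in> span ?B" by (rule span_scale)
    then show ?thesis using d by simp
  qed
  then have span: "span ?B = UNIV" by auto
  have "card ?B \<le> 3"
    using card_length[of "[x, q x, q (q x)]"] by simp
  moreover have "dim (UNIV :: (real^3) set) = 3" by simp
  ultimately have "independent ?B"
    by (intro card_le_dim_spanning[of _ UNIV]) (auto simp: span)
  then show ?thesis using span by (simp add: induces_q_basis_def)
qed

text \<open>Twice the gap is the sum of the squared coordinate differences. It vanishes only if
  \<open>q x = x\<close>, and then the three vectors collapse to one, which cannot span.\<close>

lemma q_basis_inner_less:
  assumes "induces_q_basis x"
  shows "x \<bullet> q x < x \<bullet> x"
proof -
  have "q x \<noteq> x"
  proof
    assume eq: "q x = x"
    then have "dim (UNIV :: (real^3) set) \<le> card {x}"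
      using assms by (intro dim_le_card) (auto simp: induces_q_basis_def)
    then show False by simp
  qed
  then have "\<not> (x$1 = x$2 \<and> x$2 = x$3)"
    by (auto simp: vec_eq_iff forall_3 q_component)
  then have "(x$1 - x$2)\<^sup>2 + (x$2 - x$3)\<^sup>2 + (x$3 - x$1)\<^sup>2 > 0"
    by (smt (verit) zero_le_power2 zero_less_power2 right_minus_eq)
  then show ?thesis
    unfolding inner_3 q_component by (simp add: power2_eq_square algebra_simps)
qed

lemma inner_plus_inner_q: "x \<bullet> x + 2 * (x \<bullet> q x) = (x$1 + x$2 + x$3)\<^sup>2"
  unfolding inner_3 q_component by (simp add: power2_eq_square algebra_simps)

text \<open>Both positive quantities combine \<open>x \<bullet> x > 0\<close> with the square of the
  coordinate sum, using nonnegative coefficients. Together with \<open>?G - ?H \<ge> 0\<close> they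
  put the quotient in the range where \<open>cos\<close> inverts \<open>arccos\<close>.\<close>

lemma circulant_angle:
  assumes g: "g p = circulant a b" and ab: "a > b" "b > 0" and x: "x \<noteq> 0"
  shows "inner_g g p x x > 0" "inner_g g p x x + inner_g g p x (q x) > 0"
    "x \<bullet> q x \<le> x \<bullet> x \<Longrightarrow> cos (angle_g g p x (q x)) = inner_g g p x (q x) / inner_g g p x x"
proof -
  let ?P = "x \<bullet> x" and ?Q = "x \<bullet> q x" and ?G = "inner_g g p x x" and ?H = "inner_g g p x (q x)"
  have P: "?P > 0" using x by simp
  have s: "?P + 2 * ?Q \<ge> 0" by (simp add: inner_plus_inner_q)
  have G: "?G = (a - b) * ?P + b * (?P + 2 * ?Q)"
    unfolding inner_g_circulant[where g = g and p = p, OF g] by (simp add: algebra_simps)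
  have GH: "2 * (?G + ?H) = (a - b) * (?P + (?P + 2 * ?Q)) + 4 * b * (?P + 2 * ?Q)"
    unfolding inner_g_circulant[where g = g and p = p, OF g] by (simp add: algebra_simps)
  show G0: "?G > 0"
    unfolding G using P s ab by (intro add_pos_nonneg mult_pos_pos mult_nonneg_nonneg) auto
  have "2 * (?G + ?H) > 0"
    unfolding GH using P s ab by (intro add_pos_nonneg mult_pos_pos mult_nonneg_nonneg) auto
  then show GH0: "?G + ?H > 0" by simp
  assume "?Q \<le> ?P"
  then have "0 \<le> (a - b) * (?P - ?Q)" using ab by simp
  also have "\<dots> = ?G - ?H"
    unfolding inner_g_circulant[where g = g and p = p, OF g] by (simp add: algebra_simps)
  finally have "-1 \<le> ?H / ?G" "?H / ?G \<le> 1"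
    using G0 GH0 by (simp_all add: field_simps)
  then show "cos (angle_g g p x (q x)) = ?H / ?G"
    using G0 by (simp add: angle_g_def inner_g_circulant(3)[where g = g and p = p, OF g])
qed

text \<open>This supplies the vectors that \<open>mu\<close> needs at the angles
  \<open>pi / 2\<close> and \<open>pi / 3\<close>.\<close>

lemma exists_q_basis_with_cos:
  assumes g: "g p = circulant a b" and ab: "a > b" "b > 0" and k: "-1/2 < k" "k < 1"
  obtains x where "induces_q_basis x" "angle_g g p x (q x) = arccos k"
proof -
  \<comment> \<open>For the vector \<open>x\<close> below,
    \<open>g(x, x) = 3 (a + 2 b) + 6 (a - b) r^2\<close> and
    \<open>g(x, q x) = 3 (a + 2 b) - 3 (a - b) r^2\<close>; requiring the quotient \<open>k\<close>
    determines \<open>r^2\<close>.\<close>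
  define r where "r = sqrt ((1 - k) * (a + 2 * b) / ((1 + 2 * k) * (a - b)))"
  have pos: "(1 - k) * (a + 2 * b) / ((1 + 2 * k) * (a - b)) > 0"
    using ab k by (intro divide_pos_pos mult_pos_pos) auto
  have r2: "(1 + 2 * k) * (a - b) * r\<^sup>2 = (1 - k) * (a + 2 * b)"
    unfolding r_def real_sqrt_pow2[OF less_imp_le[OF pos]] using ab k by simp
  have "r > 0" unfolding r_def using pos by (simp only: real_sqrt_gt_0_iff)
  then have r: "r \<noteq> 0" by simp
  \<comment> \<open>The axis \<open>(1, 1, 1)\<close> of \<open>q\<close> plus the multiple \<open>r\<close> of a vector orthogonal to it; \<open>r\<close> tunes the angle.\<close>
  define x :: "real^3" where "x = vector [1 + 2 * r, 1 - r, 1 - r]"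
  have P: "x \<bullet> x = 3 + 6 * r\<^sup>2" and Q: "x \<bullet> q x = 3 - 3 * r\<^sup>2"
    unfolding inner_3 q_component by (simp_all add: x_def power2_eq_square algebra_simps)
  have basis: "induces_q_basis x"
    by (rule induces_q_basisI) (use r P Q in \<open>simp_all add: x_def\<close>)
  have x: "x \<noteq> 0" using P zero_le_power2[of r] by (auto simp: add_nonneg_eq_0_iff)
  have "inner_g g p x (q x) = k * inner_g g p x x"
    unfolding inner_g_circulant[where g = g and p = p, OF g] P Q using r2 by algebra
  then have "angle_g g p x (q x) = arccos k"
    using circulant_angle(1)[where g = g and p = p, OF g ab x]
    by (simp add: angle_g_def inner_g_circulant(3)[where g = g and p = p, OF g])
  with basis show thesis by (rule that)
qed

text \<open>The denominator is \<open>(G - H) * (G + H)\<close>, and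
  \<open>G - H = (a - b) * (?P - ?Q)\<close> cancels the factor \<open>?P - ?Q\<close> of the
  curvature. Writing the rest through \<open>G\<close> and \<open>H = G * cos \<phi>\<close> cancels
  \<open>G\<close> too.\<close>

lemma sectional_q_basis:
  assumes g: "g p = circulant a b" and ab: "a > b" "b > 0"
    and curv: "curvature c g D p x (q x) x (q x) =
      (x \<bullet> x - x \<bullet> q x) * (r * (x \<bullet> x) + s * (x \<bullet> q x))"
    and basis: "induces_q_basis x"
    and angle: "angle_g g p x (q x) = \<phi>"
  shows "1 + cos \<phi> > 0"
    and "sectional c g D p x (q x) =
      ((r * (a + b) - s * b) + (s * a - 2 * r * b) * cos \<phi>) / ((a - b)\<^sup>2 * (a + 2 * b)) / (1 + cos \<phi>)"
proof -
  let ?P = "x \<bullet> x" and ?Q = "x \<bullet> q x" and ?k = "cos \<phi>"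
  define G H where GH: "G = inner_g g p x x" "H = inner_g g p x (q x)"
  note circ = inner_g_circulant[where g = g and p = p, OF g]
  have PQ: "?Q < ?P" using basis by (rule q_basis_inner_less)
  have x: "x \<noteq> 0" using PQ by auto
  note ca = circulant_angle[where g = g and p = p, OF g ab x, folded GH]
  have G: "G > 0" by (rule ca(1))
  have H: "H = ?k * G" using ca(3) PQ G angle by simp
  have "G + H > 0" by (rule ca(2))
  then have "G * (1 + ?k) > 0" by (simp add: H algebra_simps)
  then show k: "1 + ?k > 0" using G by (simp add: zero_less_mult_iff)
  define M where "M = (r * (a + b) - s * b) + (s * a - 2 * r * b) * ?k"
  have G_eq: "G = a * ?P + 2 * b * ?Q" and H_eq: "H = b * ?P + (a + b) * ?Q"
    by (simp_all add: GH circ)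
  \<comment> \<open>The linear system \<open>G_eq\<close>, \<open>H_eq\<close> has determinant
    \<open>(a - b) * (a + 2 * b)\<close> and is solved for \<open>?P\<close> and \<open>?Q\<close>
    by Cramer's rule.\<close>
  have GM: "(a - b) * (a + 2 * b) * (r * ?P + s * ?Q) = G * M"
  proof -
    have "(a - b) * (a + 2 * b) * (r * ?P + s * ?Q) =
        r * ((a + b) * G - 2 * b * H) + s * (a * H - b * G)"
      unfolding G_eq H_eq by algebra
    also have "\<dots> = G * M" unfolding H M_def by algebra
    finally show ?thesis .
  qed
  have den: "G * G - H\<^sup>2 = (?P - ?Q) * ((a - b) * (G * (1 + ?k)))"
  proof -
    have "G * G - H\<^sup>2 = (G - H) * (G + H)" by algebra
    also have "G - H = (a - b) * (?P - ?Q)" unfolding G_eq H_eq by algebra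
    also have "G + H = G * (1 + ?k)" unfolding H by algebra
    finally show ?thesis by algebra
  qed
  have "sectional c g D p x (q x) = (r * ?P + s * ?Q) / ((a - b) * (G * (1 + ?k)))"
    using PQ by (simp add: sectional_def curv circ(3) GH[symmetric] den)
  also have "r * ?P + s * ?Q = G * M / ((a - b) * (a + 2 * b))"
    using GM ab by (subst nonzero_eq_divide_eq) (simp_all add: mult.commute)
  also have "\<dots> / ((a - b) * (G * (1 + ?k))) = M / ((a - b)\<^sup>2 * (a + 2 * b)) / (1 + ?k)"
    using G by (simp add: power2_eq_square ac_simps)
  finally show "sectional c g D p x (q x) = M / ((a - b)\<^sup>2 * (a + 2 * b)) / (1 + ?k)" .
qed

section \<open>Sectional curvature of a q-basis as a function of its angle\<close>

theorem theorem4p2: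
  fixes M :: "'m topology" and \<A> :: "'m chart set" and G :: "'m chart \<Rightarrow> 'm \<Rightarrow> real^3^3"
    and c :: "'m chart" and A B :: "'m \<Rightarrow> real"
    and nabla :: "('m \<Rightarrow> real^3) \<Rightarrow> ('m \<Rightarrow> real^3) \<Rightarrow> 'm \<Rightarrow> real^3"
    and p :: 'm and u :: "real^3" and \<phi> :: real
  assumes "smooth_manifold M \<A>"
    and "riemannian_metric \<A> G"
    and "c \<in> \<A>"
    and "smooth_fun c A" and "smooth_fun c B"
    and "\<And>r. r \<in> fst c \<Longrightarrow> A r > B r \<and> B r > 0"
    and "\<And>r. r \<in> fst c \<Longrightarrow> G c r = circulant (A r) (B r)"
    and "levi_civita c (G c) nabla"
    and "\<And>r x y z w. r \<in> fst c \<Longrightarrow>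
      curvature c (G c) nabla r (q x) (q y) (q z) (q w) = curvature c (G c) nabla r x y z w"
    and "p \<in> fst c"
    and "induces_q_basis u"
    and "\<phi> = angle_g (G c) p u (q u)"
  shows "mu c (G c) nabla p \<phi> =
    (1 - 2 * cos \<phi>) / (1 + cos \<phi>) * mu c (G c) nabla p (pi / 2)
    + 3 * cos \<phi> / (1 + cos \<phi>) * mu c (G c) nabla p (pi / 3)"
proof -
  note p = \<open>p \<in> fst c\<close>
  have chart: "is_chart M c"
    using assms(1,3) by (simp add: smooth_manifold_def)
  then have open_image: "open (snd c ` fst c)" and "openin M (fst c)"
    by (auto simp: is_chart_def)
  have inj: "inj_on (snd c) (fst c)"
    using chart homeomorphic_imp_injective_map openin_subset[OF \<open>openin M (fst c)\<close>]
    by (fastforce simp: is_chart_def topspace_subtopology Int_absorb1)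
  note conn = assms(8)[unfolded levi_civita_def, THEN conjunct1]
  let ?R = "curvature c (G c) nabla p"
  have diag: "?R x y z z = 0" for x y z
  proof (rule levi_civita_curvature_diagonal[OF open_image inj assms(8) p])
    show "transpose (G c r) = G c r" if "r \<in> fst c" for r
      using assms(7)[OF that] by (simp add: transpose_circulant)
    show "smooth_fun c (\<lambda>r. inner_g (G c) r z z)"
    proof (rule smooth_fun_cong[OF open_image])
      \<comment> \<open>For constant \<open>z\<close>, \<open>g(z, z)\<close> is a fixed linear
        combination of \<open>A\<close> and \<open>B\<close>, hence smooth.\<close>
      show "smooth_fun c (\<lambda>r. z \<bullet> z * A r + 2 * (z \<bullet> q z) * B r)"
        by (rule smooth_fun_linear_combination[OF open_image assms(4,5)])
      show "z \<bullet> z * A r + 2 * (z \<bullet> q z) * B r = inner_g (G c) r z z" if "r \<in> fst c" for r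
        using inner_g_circulant(1)[of "G c" r, OF assms(7)[OF that]] by (simp add: mult_ac)
    qed
  qed
  note lin3 = curvature_linear_3[OF open_image conn p, where g = "G c"]
    and lin4 = curvature_linear_4[of c "G c" nabla p]
  have anti34: "?R x y w z = - ?R x y z w" for x y z w
    \<comment> \<open>Polarization: the diagonal value at \<open>z + w\<close> expands to the two
      mixed terms.\<close>
    using diag[of x y "1 *\<^sub>R z + 1 *\<^sub>R w"] unfolding lin3 lin4
    by (simp add: diag)
  obtain r s where form: "\<And>x. ?R x (q x) x (q x) =
      (x \<bullet> x - x \<bullet> q x) * (r * (x \<bullet> x) + s * (x \<bullet> q x))"
    using q_invariant_curvature_form[of ?R, OF
        curvature_linear_1[OF open_image conn p] curvature_antisym_12[OF open_image conn p]
        lin3 anti34 assms(9)[OF p]] by blast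
  let ?g = "G c"
  have g: "?g p = circulant (A p) (B p)" and ab: "A p > B p" "B p > 0"
    using assms(6,7) p by auto
  note sec = sectional_q_basis[where g = ?g and p = p, OF g ab form]
  obtain \<alpha> \<beta> where sec_eq: "\<And>x \<theta>. induces_q_basis x \<Longrightarrow> angle_g ?g p x (q x) = \<theta> \<Longrightarrow>
      sectional c ?g nabla p x (q x) = (\<alpha> + \<beta> * cos \<theta>) / (1 + cos \<theta>)"
  proof
    let ?d = "(A p - B p)\<^sup>2 * (A p + 2 * B p)"
    fix x \<theta> assume "induces_q_basis x" "angle_g ?g p x (q x) = \<theta>"
    from sec(2)[OF this] show "sectional c ?g nabla p x (q x) =
        ((r * (A p + B p) - s * B p) / ?d + (s * A p - 2 * r * B p) / ?d * cos \<theta>) / (1 + cos \<theta>)"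
      by (simp add: add_divide_distrib)
  qed
  \<comment> \<open>By \<open>sec_eq\<close> the value depends on the angle alone, so one witness
    \<open>x\<close> makes the definite description in \<open>mu\<close> denote it.\<close>
  have mu_eq: "mu c ?g nabla p \<theta> = (\<alpha> + \<beta> * cos \<theta>) / (1 + cos \<theta>)"
    if "induces_q_basis x" "angle_g ?g p x (q x) = \<theta>" for x \<theta>
    unfolding mu_def using that sec_eq by (intro the_equality) auto
  have mu_phi: "mu c ?g nabla p \<phi> = (\<alpha> + \<beta> * cos \<phi>) / (1 + cos \<phi>)"
    using mu_eq assms(11,12) by simp
  have k: "1 + cos \<phi> > 0"
    using sec(1)[OF assms(11)] assms(12) by simp
  have pi2: "pi / 2 = arccos 0" by simp
  have pi3: "pi / 3 = arccos (1 / 2)"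
    using arccos_cos[of "pi / 3"] by (simp add: cos_60)
  have "mu c ?g nabla p (pi / 2) = \<alpha>"
    using exists_q_basis_with_cos[where g = ?g and p = p, OF g ab, of 0] mu_eq[of _ "pi / 2"]
    unfolding pi2[symmetric] by fastforce
  moreover have "mu c ?g nabla p (pi / 3) = (2 * \<alpha> + \<beta>) / 3"
    using exists_q_basis_with_cos[where g = ?g and p = p, OF g ab, of "1 / 2"] mu_eq[of _ "pi / 3"]
    unfolding pi3[symmetric] by (fastforce simp: cos_60 field_simps)
  \<comment> \<open>Solving gives \<beta> as three times the value at \<open>pi / 3\<close> minus
    twice the value at \<open>pi / 2\<close>, to be inserted in \<open>mu_phi\<close>.\<close>
  ultimately show ?thesis
    unfolding mu_phi using k by (simp add: add_divide_distrib[symmetric] algebra_simps)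
qed

end
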